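(* Let $(T,\omega)$ and $(T',\omega')$ be weighted stars such that $M_{(T,\mathsf m_\omega)}(\mathbf z)=M_{(T',\mathsf m_{\omega'})}(\mathbf z)$. Then $(T,\omega)$ and $(T',\omega')$ are $\omega$-isomorphic. (That is, a weighted star can be reconstructed from its $M$-polynomial.)
   Context: A weighted tree is $(T,\omega)$, $T$ a tree, $\omega:V(T)\to\{1,2,\dots\}$; it is a weighted star if $T$ is a star (a tree with a vertex adjacent to all others). Two weighted graphs are $\omega$-isomorphic if there is a graph isomorphism preserving weights. The marked version $\mathsf m_\omega$ gives vertex $v$ the mark $(\omega(v),0)$; marks are pairs $(w,d)$ with dot-sum $(w,d)\dotplus(w',d')=(w+w',d+d'+1)$. For a marked tree, $M_{(T,\mathsf m)}(\mathbf z)=\sum_{A\subseteq E(T)}\prod_C z_{\mathsf m(C)}$, where $C$ ranges over connected components of $(V(T),A)$, $\mathsf m(C)$ is the dot-sum of the marks of the vertices of $C$, and the $z_{w,d}$ are commuting indeterminates. *)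

theory Defs
  imports "HOL-Library.Poly_Mapping"
begin

text \<open>
  A finite simple graph is given by its vertex set \<open>V\<close> and its set \<open>E\<close> of two-element edges.
  The notion of tree from the AFP entry \<open>Graph_Theory\<close> is not usable here: it forbids directed
  cycles, and a symmetric digraph with an arc always has a directed cycle of length two.
\<close>

definition simple_graph :: "'a set \<Rightarrow> 'a set set \<Rightarrow> bool" where
  "simple_graph V E \<longleftrightarrow> finite V \<and> (\<forall>e\<in>E. e \<subseteq> V \<and> card e = 2)"

definition linked :: "'a set set \<Rightarrow> ('a \<times> 'a) set" where
  "linked E = {(u, v). {u, v} \<in> E}\<^sup>*"

definition connected_graph :: "'a set \<Rightarrow> 'a set set \<Rightarrow> bool" where
  "connected_graph V E \<longleftrightarrow> V \<noteq> {} \<and> (\<forall>u\<in>V. \<forall>v\<in>V. (u, v) \<in> linked E)"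

definition is_cycle :: "'a set set \<Rightarrow> 'a list \<Rightarrow> bool" where
  "is_cycle E c \<longleftrightarrow> 3 \<le> length c \<and> distinct c \<and>
     (\<forall>i<length c. {c ! i, c ! (Suc i mod length c)} \<in> E)"

definition is_tree :: "'a set \<Rightarrow> 'a set set \<Rightarrow> bool" where
  "is_tree V E \<longleftrightarrow> simple_graph V E \<and> connected_graph V E \<and> (\<nexists>c. is_cycle E c)"

definition is_star :: "'a set \<Rightarrow> 'a set set \<Rightarrow> bool" where
  "is_star V E \<longleftrightarrow> is_tree V E \<and> (\<exists>c\<in>V. \<forall>v\<in>V - {c}. {c, v} \<in> E)"

definition weighted_tree :: "'a set \<Rightarrow> 'a set set \<Rightarrow> ('a \<Rightarrow> nat) \<Rightarrow> bool" where
  "weighted_tree V E \<omega> \<longleftrightarrow> is_tree V E \<and> (\<forall>v\<in>V. 1 \<le> \<omega> v)"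

definition weighted_star :: "'a set \<Rightarrow> 'a set set \<Rightarrow> ('a \<Rightarrow> nat) \<Rightarrow> bool" where
  "weighted_star V E \<omega> \<longleftrightarrow> weighted_tree V E \<omega> \<and> is_star V E"

definition weight_isomorphic ::
  "'a set \<Rightarrow> 'a set set \<Rightarrow> ('a \<Rightarrow> nat) \<Rightarrow> 'b set \<Rightarrow> 'b set set \<Rightarrow> ('b \<Rightarrow> nat) \<Rightarrow> bool" where
  "weight_isomorphic V E \<omega> V' E' \<omega>' \<longleftrightarrow>
     (\<exists>f. bij_betw f V V' \<and>
          (\<forall>u\<in>V. \<forall>v\<in>V. {u, v} \<in> E \<longleftrightarrow> {f u, f v} \<in> E') \<and>
          (\<forall>v\<in>V. \<omega>' (f v) = \<omega> v))"

definition components :: "'a set \<Rightarrow> 'a set set \<Rightarrow> 'a set set" where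
  "components V A = V // (linked A \<inter> V \<times> V)"

type_synonym mark = "nat \<times> nat"

fun dot_plus :: "mark \<Rightarrow> mark \<Rightarrow> mark" where
  "dot_plus (w, d) (w', d') = (w + w', d + d' + 1)"

lemma dot_plus_eq: "dot_plus p q = (fst p + fst q, snd p + snd q + 1)"
  by (cases p; cases q) simp

text \<open>
  The operation \<^const>\<open>dot_plus\<close> has no neutral element, so the dot-sum of a nonempty finite family
  is folded from an arbitrary member. The two facts \<open>dot_sum_singleton\<close> and \<open>dot_sum_insert\<close> below
  characterise it; in particular the choice of the member is immaterial.
\<close>

definition dot_sum :: "('a \<Rightarrow> mark) \<Rightarrow> 'a set \<Rightarrow> mark" where
  "dot_sum m C =
     (let a = (SOME a. a \<in> C) in Finite_Set.fold (\<lambda>v. dot_plus (m v)) (m a) (C - {a}))"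

lemma fold_dot_plus:
  assumes "finite B"
  shows "Finite_Set.fold (\<lambda>v. dot_plus (m v)) x B =
    (fst x + (\<Sum>v\<in>B. fst (m v)), snd x + (\<Sum>v\<in>B. snd (m v)) + card B)"
proof -
  interpret comp_fun_commute "\<lambda>v. dot_plus (m v)"
    by unfold_locales (simp add: dot_plus_eq fun_eq_iff)
  from assms show ?thesis
  proof (induction B rule: finite_induct)
    case empty
    show ?case by simp
  next
    case (insert v B)
    show ?case
      unfolding fold_insert[OF insert.hyps] insert.IH
      using insert.hyps by (simp add: dot_plus_eq)
  qed
qed

lemma dot_sum_eq:
  assumes "finite C" "C \<noteq> {}"
  shows "dot_sum m C = (\<Sum>v\<in>C. fst (m v), (\<Sum>v\<in>C. snd (m v)) + (card C - 1))"
proof -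
  define a where "a = (SOME a. a \<in> C)"
  have "a \<in> C"
    using assms(2) by (simp add: a_def some_in_eq)
  then show ?thesis
    using assms unfolding dot_sum_def Let_def a_def[symmetric]
    by (simp add: fold_dot_plus sum.remove[of C a])
qed

lemma dot_sum_singleton: "dot_sum m {v} = m v"
  by (simp add: dot_sum_eq)

lemma dot_sum_insert:
  assumes "finite C" "C \<noteq> {}" "v \<notin> C"
  shows "dot_sum m (insert v C) = dot_plus (m v) (dot_sum m C)"
proof -
  have "card C > 0"
    using assms by (simp add: card_gt_0_iff)
  then show ?thesis
    using assms by (simp add: dot_sum_eq dot_plus_eq)
qed

text \<open>
  Integer polynomials in the commuting indeterminates \<open>z\<^bsub>w,d\<^esub>\<close>: finitely supported functions from
  monomials (finitely supported exponent functions) to coefficients, with convolution as product.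
\<close>

type_synonym mark_poly = "(mark \<Rightarrow>\<^sub>0 nat) \<Rightarrow>\<^sub>0 int"

definition z_var :: "mark \<Rightarrow> mark_poly" where
  "z_var p = Poly_Mapping.single (Poly_Mapping.single p 1) 1"

definition M_poly :: "'a set \<Rightarrow> 'a set set \<Rightarrow> ('a \<Rightarrow> mark) \<Rightarrow> mark_poly" where
  "M_poly V E m = (\<Sum>A\<in>Pow E. \<Prod>C\<in>components V A. z_var (dot_sum m C))"

definition weight_mark :: "('a \<Rightarrow> nat) \<Rightarrow> 'a \<Rightarrow> mark" where
  "weight_mark \<omega> v = (\<omega> v, 0)"

end

theory Submission
  imports Defs "HOL-Combinatorics.Permutations"
begin

text \<open>
  Every coefficient of the \<open>M\<close>-polynomial is a number of edge sets, so nothing cancels and the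
  polynomial determines the set of monomials of the edge sets \<open>A\<close>. The factors \<open>z\<^bsub>w,0\<^esub>\<close> of such a
  monomial record the multiset of weights of the vertices not covered by \<open>A\<close>. The largest of these
  multisets is \<open>W\<close>, the multiset of all weights (\<open>A\<close> empty); those with two elements less give the
  weight pairs of the edges. If two stars with these data have centers of different weights \<open>a\<close> and
  \<open>b\<close>, every edge has weights \<open>a, b\<close>, so \<open>W\<close> consists of one \<open>a\<close> and otherwise \<open>b\<close>'s, but also of
  one \<open>b\<close> and otherwise \<open>a\<close>'s. Hence there is only one edge, and either end of it is a center.
\<close>

section \<open>Monomials of edge sets\<close>

text \<open>The exponent vector of the product that \<open>A\<close> contributes to
  \<open>M_poly\<close>: the exponent at a mark is the number of components with that
  dot-sum.\<close>

definition edge_monomial :: "'a set \<Rightarrow> ('a \<Rightarrow> mark) \<Rightarrow> 'a set set \<Rightarrow> mark \<Rightarrow>\<^sub>0 nat" where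
  "edge_monomial V m A = (\<Sum>C\<in>components V A. Poly_Mapping.single (dot_sum m C) 1)"

lemma prod_z_var:
  "(\<Prod>C\<in>X. z_var (f C)) = Poly_Mapping.single (\<Sum>C\<in>X. Poly_Mapping.single (f C) 1) 1"
  by (induction X rule: infinite_finite_induct) (simp_all add: z_var_def mult_single)

lemma lookup_sum_single:
  fixes f :: "'i \<Rightarrow> 'k"
  assumes "finite X"
  shows "Poly_Mapping.lookup (\<Sum>x\<in>X. Poly_Mapping.single (f x) (1 :: 'b :: semiring_1)) k =
    of_nat (card {x \<in> X. f x = k})"
  using assms
  by (simp add: lookup_sum lookup_single when_def sum.If_cases Int_def)

lemma finite_components: "finite V \<Longrightarrow> finite (components V A)"
  unfolding components_def by (rule finite_quotient) auto

text \<open>The coefficient at a monomial is the number of edge sets producing it, taken as an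
  integer, so it vanishes only when there is no such edge set.\<close>

lemma keys_M_poly:
  assumes "finite E"
  shows "Poly_Mapping.keys (M_poly V E m) = edge_monomial V m ` Pow E"
proof -
  have "M_poly V E m = (\<Sum>A\<in>Pow E. Poly_Mapping.single (edge_monomial V m A) 1)"
    by (simp add: M_poly_def edge_monomial_def prod_z_var)
  then have "k \<in> Poly_Mapping.keys (M_poly V E m) \<longleftrightarrow> k \<in> edge_monomial V m ` Pow E" for k
    using assms by (auto simp: in_keys_iff lookup_sum_single card_eq_0_iff)
  then show ?thesis by blast
qed

section \<open>Weights of uncovered vertices\<close>

definition weights :: "('a \<Rightarrow> nat) \<Rightarrow> 'a set \<Rightarrow> nat multiset" where
  "weights \<omega> X = image_mset \<omega> (mset_set X)"

lemma count_weights: "finite X \<Longrightarrow> count (weights \<omega> X) w = card {v \<in> X. \<omega> v = w}"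
  by (simp add: weights_def count_image_mset_eq_card_vimage)

lemma size_weights: "size (weights \<omega> X) = card X"
  by (simp add: weights_def)

lemma weights_Diff:
  "finite X \<Longrightarrow> Y \<subseteq> X \<Longrightarrow> weights \<omega> (X - Y) = weights \<omega> X - weights \<omega> Y"
  by (simp add: weights_def mset_set_Diff image_mset_Diff finite_subset)

lemma weights_mono: "finite X \<Longrightarrow> Y \<subseteq> X \<Longrightarrow> weights \<omega> Y \<subseteq># weights \<omega> X"
  by (simp add: weights_def image_mset_subseteq_mono subset_imp_msubset_mset_set)

text \<open>Since the cardinalities agree, some bijection \<open>g\<close> exists; it may ignore
  weights. Then \<omega> and \<open>\<omega>' \<circ> g\<close> have the same image multiset on
  \<open>X\<close>, so they differ by a permutation of \<open>X\<close>, which corrects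
  \<open>g\<close>.\<close>

lemma weights_eq_imp_bij:
  assumes "finite X" "finite Y" "weights \<omega> X = weights \<omega>' Y"
  obtains f where "bij_betw f X Y" "\<And>x. x \<in> X \<Longrightarrow> \<omega>' (f x) = \<omega> x"
proof -
  have "card X = card Y" using assms(3) by (metis size_weights)
  then obtain g where g: "bij_betw g X Y" using assms(1,2) finite_same_card_bij by blast
  have "mset_set Y = image_mset g (mset_set X)"
    using g by (simp add: bij_betw_def image_mset_mset_set)
  then have "image_mset \<omega> (mset_set X) = image_mset (\<omega>' \<circ> g) (mset_set X)"
    using assms(3) by (simp add: weights_def multiset.map_comp)
  then obtain p where p: "p permutes X" "\<forall>x\<in>X. \<omega> x = (\<omega>' \<circ> g) (p x)"
    using image_mset_eq_implies_permutes[OF assms(1)] by metis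
  show thesis
  proof (rule that)
    show "bij_betw (g \<circ> p) X Y" using permutes_imp_bij[OF p(1)] g by (rule bij_betw_trans)
    show "\<omega>' ((g \<circ> p) x) = \<omega> x" if "x \<in> X" for x using p(2) that by simp
  qed
qed

section \<open>Isolated vertices as one-vertex components\<close>

lemma simple_graph_subset: "simple_graph V E \<Longrightarrow> A \<subseteq> E \<Longrightarrow> simple_graph V A"
  by (auto simp: simple_graph_def)

lemma simple_graph_finite:
  assumes "simple_graph V E"
  shows "finite V" "finite E"
proof -
  show "finite V" using assms by (simp add: simple_graph_def)
  moreover have "E \<subseteq> Pow V" using assms by (auto simp: simple_graph_def)
  ultimately show "finite E" by (meson finite_Pow_iff finite_subset)
qed

lemma simple_graph_edgeE:
  assumes "simple_graph V E" "e \<in> E" "v \<in> e"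
  obtains u where "e = {v, u}" "u \<noteq> v" "u \<in> V" "v \<in> V"
proof -
  have "card e = 2" "e \<subseteq> V" using assms by (auto simp: simple_graph_def)
  then show thesis using assms(3) that by (auto simp: card_2_iff)
qed

lemma linked_uncovered:
  assumes "v \<notin> \<Union>A" shows "(v, u) \<in> linked A \<longleftrightarrow> u = v"
proof
  assume "(v, u) \<in> linked A"
  then show "u = v" unfolding linked_def
    by (cases rule: converse_rtranclE) (use assms in auto)
qed (simp add: linked_def)

lemma component_singleton_iff:
  assumes "simple_graph V A" "v \<in> V"
  shows "(linked A \<inter> V \<times> V) `` {v} = {v} \<longleftrightarrow> v \<notin> \<Union>A"
proof
  assume C: "(linked A \<inter> V \<times> V) `` {v} = {v}"
  show "v \<notin> \<Union>A"
  proof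
    assume "v \<in> \<Union>A"
    then obtain e where "e \<in> A" "v \<in> e" by blast
    then obtain u where u: "e = {v, u}" "u \<noteq> v" "u \<in> V"
      using assms(1) by (metis simple_graph_edgeE)
    with \<open>e \<in> A\<close> have "(v, u) \<in> linked A" by (auto simp: linked_def)
    with u assms(2) C show False by auto
  qed
qed (use assms(2) in \<open>auto simp: linked_uncovered\<close>)

text \<open>All weight marks have second entry 0, so the dot-sum over \<open>C\<close> has second
  entry \<open>card C - 1\<close>. It is 0 exactly for one-vertex components, that is, for vertices
  on no edge of \<open>A\<close>.\<close>

lemma components_with_single_mark:
  assumes "simple_graph V A"
  shows "{C \<in> components V A. dot_sum (weight_mark \<omega>) C = (w, 0)} =
    (\<lambda>v. {v}) ` {v \<in> V - \<Union>A. \<omega> v = w}"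
proof (intro equalityI subsetI)
  fix C assume "C \<in> {C \<in> components V A. dot_sum (weight_mark \<omega>) C = (w, 0)}"
  then obtain v where v: "v \<in> V" "C = (linked A \<inter> V \<times> V) `` {v}"
    and w: "dot_sum (weight_mark \<omega>) C = (w, 0)"
    by (auto simp: components_def quotient_def)
  have "v \<in> C" using v by (auto simp: linked_def)
  moreover have "finite C" using v(2) simple_graph_finite(1)[OF assms]
    by (auto intro: finite_subset[of _ V])
  \<comment> \<open>Subtraction is truncated, so \<open>card C - 1 = 0\<close> alone would not
    exclude cardinality 0.\<close>
  ultimately have "card C \<noteq> 0" "card C - 1 = 0" "(\<Sum>v\<in>C. \<omega> v) = w"
    using w dot_sum_eq[of C "weight_mark \<omega>"] by (auto simp: weight_mark_def)
  then have "card C = 1" "(\<Sum>v\<in>C. \<omega> v) = w" by linarith+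
  with \<open>v \<in> C\<close> have "C = {v}" "\<omega> v = w" by (auto simp: card_1_singleton_iff)
  with v show "C \<in> (\<lambda>v. {v}) ` {v \<in> V - \<Union>A. \<omega> v = w}"
    using component_singleton_iff[OF assms v(1)] by blast
next
  fix C assume "C \<in> (\<lambda>v. {v}) ` {v \<in> V - \<Union>A. \<omega> v = w}"
  then obtain v where v: "v \<in> V" "v \<notin> \<Union>A" "\<omega> v = w" "C = {v}" by blast
  then have "C \<in> components V A"
    using component_singleton_iff[OF assms v(1)] by (auto simp: components_def quotient_def)
  with v show "C \<in> {C \<in> components V A. dot_sum (weight_mark \<omega>) C = (w, 0)}"
    by (simp add: dot_sum_singleton weight_mark_def)
qed

lemma lookup_edge_monomial:
  assumes "simple_graph V A"
  shows "Poly_Mapping.lookup (edge_monomial V (weight_mark \<omega>) A) (w, 0) =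
    count (weights \<omega> (V - \<Union>A)) w"
proof -
  have fin: "finite V" by (rule simple_graph_finite(1)[OF assms])
  have "Poly_Mapping.lookup (edge_monomial V (weight_mark \<omega>) A) (w, 0) =
      card {C \<in> components V A. dot_sum (weight_mark \<omega>) C = (w, 0)}"
    unfolding edge_monomial_def by (subst lookup_sum_single) (simp_all add: finite_components fin)
  also have "\<dots> = card {v \<in> V - \<Union>A. \<omega> v = w}"
    unfolding components_with_single_mark[OF assms] by (rule card_image) (simp add: inj_on_def)
  finally show ?thesis using fin by (simp add: count_weights)
qed

section \<open>Data shared by graphs with equal polynomials\<close>

text \<open>Equal polynomials have the same monomials, so some \<open>A'\<close> yields the monomial
  of \<open>A\<close>; comparing exponents at the marks \<open>(w, 0)\<close> suffices. The cases
  needed below are \<open>A\<close> empty and \<open>A = {e}\<close>.\<close>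

lemma M_poly_eq_imp_uncovered_weights:
  assumes "simple_graph V E" "simple_graph V' E'" "A \<subseteq> E"
    and "M_poly V E (weight_mark \<omega>) = M_poly V' E' (weight_mark \<omega>')"
  obtains A' where "A' \<subseteq> E'" "weights \<omega>' (V' - \<Union>A') = weights \<omega> (V - \<Union>A)"
proof -
  have "edge_monomial V (weight_mark \<omega>) ` Pow E = edge_monomial V' (weight_mark \<omega>') ` Pow E'"
    using assms keys_M_poly simple_graph_finite(2) by metis
  with assms(3) obtain A' where A': "A' \<subseteq> E'"
    "edge_monomial V (weight_mark \<omega>) A = edge_monomial V' (weight_mark \<omega>') A'"
    by blast
  have "weights \<omega>' (V' - \<Union>A') = weights \<omega> (V - \<Union>A)"
    using lookup_edge_monomial[OF simple_graph_subset[OF assms(1,3)], of \<omega>]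
      lookup_edge_monomial[OF simple_graph_subset[OF assms(2) A'(1)], of \<omega>'] A'(2)
    by (simp add: multiset_eq_iff)
  with A'(1) show thesis by (rule that)
qed

text \<open>The empty edge set covers nothing, so all weights of one graph occur as the uncovered
  weights of some edge set of the other, hence as a submultiset of its weights. The situation is
  symmetric.\<close>

lemma M_poly_eq_imp_weights_eq:
  assumes "simple_graph V E" "simple_graph V' E'"
    and "M_poly V E (weight_mark \<omega>) = M_poly V' E' (weight_mark \<omega>')"
  shows "weights \<omega> V = weights \<omega>' V'"
proof (rule subset_mset.antisym)
  show "weights \<omega> V \<subseteq># weights \<omega>' V'"
    using M_poly_eq_imp_uncovered_weights[OF assms(1,2) empty_subsetI assms(3)]
      weights_mono[OF simple_graph_finite(1)[OF assms(2)] Diff_subset]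
    by (metis Diff_empty Union_empty)
  show "weights \<omega>' V' \<subseteq># weights \<omega> V"
    using M_poly_eq_imp_uncovered_weights[OF assms(2,1) empty_subsetI assms(3)[symmetric]]
      weights_mono[OF simple_graph_finite(1)[OF assms(1)] Diff_subset]
    by (metis Diff_empty Union_empty)
qed

text \<open>An edge set \<open>A'\<close> matching \<open>{e}\<close> leaves all but two vertices
  uncovered, so its union is a single edge \<open>e'\<close>. Taking complements in the common
  multiset of weights gives the weight pair of \<open>e'\<close>.\<close>

lemma M_poly_eq_imp_edge_weights:
  assumes "simple_graph V E" "simple_graph V' E'" "e \<in> E"
    and "M_poly V E (weight_mark \<omega>) = M_poly V' E' (weight_mark \<omega>')"
  obtains e' where "e' \<in> E'" "weights \<omega>' e' = weights \<omega> e"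
proof -
  note fin = simple_graph_finite(1)[OF assms(1)] simple_graph_finite(1)[OF assms(2)]
  have W: "weights \<omega> V = weights \<omega>' V'"
    by (rule M_poly_eq_imp_weights_eq[OF assms(1,2,4)])
  then have cards: "card V = card V'" by (metis size_weights)
  have e: "e \<subseteq> V" "card e = 2" using assms(1,3) by (auto simp: simple_graph_def)
  obtain A' where A': "A' \<subseteq> E'" "weights \<omega>' (V' - \<Union>A') = weights \<omega> (V - e)"
    using M_poly_eq_imp_uncovered_weights[OF assms(1,2) _ assms(4), of "{e}"] assms(3) by auto
  have sub: "\<Union>A' \<subseteq> V'" using A'(1) assms(2) by (auto simp: simple_graph_def)
  then have finU: "finite (\<Union>A')" using fin(2) finite_subset by blast
  have "card (V' - \<Union>A') = card (V - e)" using A'(2) by (metis size_weights)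
  then have two: "card (\<Union>A') = 2"
    using e sub fin cards card_mono[OF fin(1) e(1)] card_mono[OF fin(2) sub]
    by (simp add: card_Diff_subset finite_subset)
  then obtain e' where e': "e' \<in> A'" by force
  then have "card e' = 2" "e' \<subseteq> \<Union>A'" using A'(1) assms(2) by (auto simp: simple_graph_def)
  then have U: "\<Union>A' = e'" using two finU by (metis card_subset_eq)
  have "weights \<omega> V - weights \<omega> e = weights \<omega> V - weights \<omega>' e'"
    using A'(2) U W sub fin e(1) by (simp add: weights_Diff)
  \<comment> \<open>Multiset difference is truncated, so cancelling needs both subtrahends to be
    contained in the whole.\<close>
  moreover have "weights \<omega> e \<subseteq># weights \<omega> V" "weights \<omega>' e' \<subseteq># weights \<omega> V"
    using weights_mono[OF fin(1) e(1), of \<omega>] weights_mono[OF fin(2) sub, of \<omega>'] W U by simp_all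
  ultimately have "weights \<omega>' e' = weights \<omega> e"
    by (metis add_left_cancel subset_mset.diff_add)
  with e' A'(1) that show thesis by blast
qed

section \<open>Stars\<close>

definition star_center :: "'a set \<Rightarrow> 'a set set \<Rightarrow> 'a \<Rightarrow> bool" where
  "star_center V E c \<longleftrightarrow> c \<in> V \<and> E = (\<lambda>v. {c, v}) ` (V - {c})"

text \<open>A vertex \<open>c\<close> adjacent to all others leaves open whether further edges
  exist; an edge avoiding \<open>c\<close> would form a triangle with it, contrary to
  acyclicity.\<close>

lemma is_star_imp_star_center:
  assumes "is_star V E"
  obtains c where "star_center V E c"
proof -
  have sg: "simple_graph V E" and acyclic: "\<nexists>p. is_cycle E p"
    using assms by (auto simp: is_star_def is_tree_def)
  obtain c where c: "c \<in> V" "\<And>v. v \<in> V - {c} \<Longrightarrow> {c, v} \<in> E"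
    using assms by (auto simp: is_star_def)
  have "e \<in> (\<lambda>v. {c, v}) ` (V - {c})" if "e \<in> E" for e
  proof (cases "c \<in> e")
    case True
    with sg that obtain u where "e = {c, u}" "u \<noteq> c" "u \<in> V" by (rule simple_graph_edgeE)
    then show ?thesis by blast
  next
    case False
    have "card e = 2" "e \<subseteq> V" using sg that by (auto simp: simple_graph_def)
    then obtain u v where "e = {u, v}" "u \<noteq> v" "u \<in> V" "v \<in> V"
      by (auto simp: card_2_iff)
    then have cycle: "{c, u} \<in> E" "{u, v} \<in> E" "{v, c} \<in> E" "distinct [c, u, v]"
      using c(2)[of u] c(2)[of v] that False by (auto simp: insert_commute[of v c])
    have "{[c, u, v] ! i, [c, u, v] ! (Suc i mod 3)} \<in> E" if "i < 3" for i
    proof -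
      from that consider "i = 0" | "i = 1" | "i = 2" by linarith
      then show ?thesis using cycle(1-3) by cases simp_all
    qed
    with cycle(4) have "is_cycle E [c, u, v]" by (simp add: is_cycle_def)
    with acyclic show ?thesis by blast
  qed
  with c have "star_center V E c" by (auto simp: star_center_def)
  then show thesis by (rule that)
qed

lemma star_center_edge_iff:
  assumes "star_center V E c" "u \<in> V" "v \<in> V"
  shows "{u, v} \<in> E \<longleftrightarrow> u \<noteq> v \<and> (u = c \<or> v = c)"
proof -
  have "E = (\<lambda>x. {c, x}) ` (V - {c})" using assms(1) by (simp add: star_center_def)
  then have "{u, v} \<in> E \<longleftrightarrow> (\<exists>x\<in>V - {c}. {u, v} = {c, x})" by blast
  also have "\<dots> \<longleftrightarrow> u \<noteq> v \<and> (u = c \<or> v = c)"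
    using assms(2,3) unfolding doubleton_eq_iff by blast
  finally show ?thesis .
qed

text \<open>Removing the equal center weights leaves equal multisets of leaf weights, hence a
  weight-preserving bijection of the leaves. Extended by sending \<open>c\<close> to
  \<open>c'\<close>, it respects edges, because adjacency in a star only depends on which vertex is
  the center.\<close>

lemma weight_isomorphic_if_centers:
  assumes "finite V" "finite V'" "star_center V E c" "star_center V' E' c'"
    and "\<omega> c = \<omega>' c'" "weights \<omega> V = weights \<omega>' V'"
  shows "weight_isomorphic V E \<omega> V' E' \<omega>'"
proof -
  have c: "c \<in> V" "c' \<in> V'" using assms(3,4) by (auto simp: star_center_def)
  have "weights \<omega> (V - {c}) = weights \<omega>' (V' - {c'})"
    using assms c by (simp add: weights_Diff) (simp add: weights_def)
  then obtain g where g: "bij_betw g (V - {c}) (V' - {c'})"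
    "\<And>v. v \<in> V - {c} \<Longrightarrow> \<omega>' (g v) = \<omega> v"
    using weights_eq_imp_bij assms(1,2) by (metis finite_Diff)
  define f where "f v = (if v = c then c' else g v)" for v
  have "bij_betw f (V - {c}) (V' - {c'})"
    using g(1) by (rule bij_betw_cong[THEN iffD1, rotated]) (simp add: f_def)
  then have bij: "bij_betw f V V'"
    using c notIn_Un_bij_betw[of c "V - {c}" f "V' - {c'}"]
    by (simp add: f_def insert_absorb)
  have "{u, v} \<in> E \<longleftrightarrow> {f u, f v} \<in> E'" if "u \<in> V" "v \<in> V" for u v
  proof -
    have inj: "f x = f y \<longleftrightarrow> x = y" if "x \<in> V" "y \<in> V" for x y
      using bij that by (metis bij_betw_imp_inj_on inj_on_eq_iff)
    have "f u \<in> V'" "f v \<in> V'" using bij that by (simp_all add: bij_betw_apply)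
    moreover have "f u = c' \<longleftrightarrow> u = c" "f v = c' \<longleftrightarrow> v = c"
      using inj[of _ c] that c by (simp_all add: f_def[of c])
    moreover have "f u = f v \<longleftrightarrow> u = v" using inj that by blast
    ultimately show ?thesis
      using star_center_edge_iff[OF assms(3) that] star_center_edge_iff[OF assms(4)] by simp
  qed
  moreover have "\<omega>' (f v) = \<omega> v" if "v \<in> V" for v
    using that g(2) assms(5) by (simp add: f_def)
  ultimately show ?thesis using bij unfolding weight_isomorphic_def by blast
qed

text \<open>The edge from \<open>c\<close> to \<open>v\<close> shares its weight pair with some edge
  at \<open>c'\<close>. So \<open>\<omega>' c'\<close> is one of the two weights, and it is not that
  of \<open>c\<close>.\<close>

lemma leaf_weight_if_centers_differ:
  assumes "simple_graph V E" "simple_graph V' E'" "star_center V E c" "star_center V' E' c'"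
    and "M_poly V E (weight_mark \<omega>) = M_poly V' E' (weight_mark \<omega>')"
    and "\<omega> c \<noteq> \<omega>' c'" "v \<in> V - {c}"
  shows "\<omega> v = \<omega>' c'"
proof -
  have "{c, v} \<in> E" using assms(3,7) by (auto simp: star_center_def)
  then obtain e' where e': "e' \<in> E'" "weights \<omega>' e' = weights \<omega> {c, v}"
    using M_poly_eq_imp_edge_weights[OF assms(1,2) _ assms(5)] by metis
  then obtain v' where "e' = {c', v'}" "v' \<noteq> c'"
    using assms(4) by (auto simp: star_center_def)
  moreover have "c \<noteq> v" using assms(7) by blast
  ultimately have "{#\<omega>' c', \<omega>' v'#} = {#\<omega> c, \<omega> v#}"
    using e'(2) by (simp add: weights_def)
  with assms(6) show ?thesis by (auto simp: add_eq_conv_ex)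
qed

lemma count_center_weight:
  assumes "finite V" "c \<in> V" "\<And>v. v \<in> V - {c} \<Longrightarrow> \<omega> v \<noteq> \<omega> c"
  shows "count (weights \<omega> V) (\<omega> c) = 1"
proof -
  have "{v \<in> V. \<omega> v = \<omega> c} = {c}" using assms(2,3) by auto
  then show ?thesis using assms(1) by (simp add: count_weights)
qed

lemma star_center_other_end:
  assumes "star_center V E c" "V = {c, v}" "v \<noteq> c"
  shows "star_center V E v"
proof -
  have "V - {c} = {v}" "V - {v} = {c}" using assms(2,3) by auto
  with assms show ?thesis by (simp add: star_center_def insert_commute[of c v])
qed

theorem theorem7p6:
  fixes V :: "'a set" and E :: "'a set set" and \<omega> :: "'a \<Rightarrow> nat"
    and V' :: "'b set" and E' :: "'b set set" and \<omega>' :: "'b \<Rightarrow> nat"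
  assumes "weighted_star V E \<omega>"
    and "weighted_star V' E' \<omega>'"
    and "M_poly V E (weight_mark \<omega>) = M_poly V' E' (weight_mark \<omega>')"
  shows "weight_isomorphic V E \<omega> V' E' \<omega>'"
proof -
  have star: "is_star V E" "is_star V' E'"
    using assms(1,2) by (auto simp: weighted_star_def)
  then have sg: "simple_graph V E" "simple_graph V' E'"
    by (auto simp: is_star_def is_tree_def)
  note fin = simple_graph_finite(1)[OF sg(1)] simple_graph_finite(1)[OF sg(2)]
  have W: "weights \<omega> V = weights \<omega>' V'"
    by (rule M_poly_eq_imp_weights_eq[OF sg assms(3)])
  obtain c c' where c: "star_center V E c" "star_center V' E' c'"
    using star is_star_imp_star_center by metis
  show ?thesis
  proof (cases "\<omega> c = \<omega>' c'")
    case True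
    then show ?thesis using weight_isomorphic_if_centers[OF fin c] W by blast
  next
    case False
    have leaf: "\<And>v. v \<in> V - {c} \<Longrightarrow> \<omega> v = \<omega>' c'"
      by (rule leaf_weight_if_centers_differ[OF sg c assms(3) False])
    have leaf': "\<And>v. v \<in> V' - {c'} \<Longrightarrow> \<omega>' v = \<omega> c"
      by (rule leaf_weight_if_centers_differ[OF sg(2,1) c(2,1) assms(3)[symmetric] False[symmetric]])
    have cV: "c \<in> V" "c' \<in> V'" using c by (auto simp: star_center_def)
    \<comment> \<open>The weight \<open>\<omega>' c'\<close> is counted in both stars: in the first,
      exactly the leaves have it; in the second, only the center does. So the first star has one
      leaf.\<close>
    have "{v \<in> V. \<omega> v = \<omega>' c'} = V - {c}" using leaf False by auto
    then have "card (V - {c}) = count (weights \<omega> V) (\<omega>' c')" using fin by (simp add: count_weights)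
    also have "\<dots> = 1"
      unfolding W using leaf' False by (intro count_center_weight fin cV) auto
    finally obtain v where "V - {c} = {v}" by (rule card_1_singletonE)
    then have v: "V = {c, v}" "v \<noteq> c" "\<omega> v = \<omega>' c'" using cV leaf by auto
    \<comment> \<open>With the leaf \<open>v\<close> taken as the center of the first star, the
      center weights agree.\<close>
    show ?thesis
      using weight_isomorphic_if_centers[OF fin star_center_other_end[OF c(1) v(1,2)] c(2) v(3) W] .
  qed
qed

end
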